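(* Let $\mathcal{T}$ be the class of dependency trees, let $|t|$ denote the number of nodes of $t\in\mathcal{T}$, and let $T(z)=\sum_{t\in\mathcal{T}} z^{|t|}$ be its ordinary generating function. Then $T(z)$ satisfies the functional equation $$T(z)=\frac{1}{1-T(z)}\cdot z\cdot\frac{1}{1-T(z)} .$$
   Context: A dependency tree is defined recursively: it consists of a root node together with a finite (possibly empty) ordered sequence of dependency trees on the left of the root and a finite (possibly empty) ordered sequence of dependency trees on the right of the root (both sequences being empty gives the single-node tree). Equivalently, $\mathcal{T}=\mathrm{SEQ}(\mathcal{T})\times\circ\times\mathrm{SEQ}(\mathcal{T})$, where $\circ$ is the root node (of size 1), $\times$ is the class of ordered pairs, and $\mathrm{SEQ}(\mathcal{A})$ is the class of finite sequences (including the empty one) of elements of $\mathcal{A}$. Nodes are unlabelled; two dependency trees are equal exactly when their left sequences coincide and their right sequences coincide. The size $|t|$ is the total number of nodes. The generating function is a formal power series in $z$ (with zero constant term). *)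

theory Defs
  imports "HOL-Computational_Algebra.Formal_Power_Series"
begin

datatype dep_tree = Node (lefts: "dep_tree list") (rights: "dep_tree list")

(* Not the automatically generated size function, which also counts the list constructors. *)
primrec num_nodes :: "dep_tree \<Rightarrow> nat" where
  "num_nodes (Node ls rs) = sum_list (map num_nodes ls) + 1 + sum_list (map num_nodes rs)"

(* The class is the whole type 'b, with size function s. The coefficient of z^n in the formal sum
   of all z^(s x) is the number of objects of size n; it is meaningful only if every size class
   is finite, which finite_dep_trees shows for dependency trees. *)
definition ogf :: "('b \<Rightarrow> nat) \<Rightarrow> 'a::semiring_1 fps" where
  "ogf s = Abs_fps (\<lambda>n. of_nat (card {x. s x = n}))"

definition dep_tree_gf :: "'a::semiring_1 fps" where
  "dep_tree_gf = ogf num_nodes"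

lemma length_le_sum_num_nodes: "length ts \<le> sum_list (map num_nodes ts)"
proof (induction ts)
  case (Cons t ts)
  then show ?case by (cases t) simp
qed simp

lemma finite_dep_trees_le: "finite {t. num_nodes t \<le> n}"
proof (induction n)
  case 0
  have "{t. num_nodes t \<le> 0} = {}"
  proof (rule equals0I)
    fix t assume "t \<in> {t. num_nodes t \<le> 0}"
    then show False by (cases t) simp
  qed
  then show ?case by (simp only: finite.emptyI)
next
  case (Suc n)
  let ?L = "{ts. set ts \<subseteq> {t. num_nodes t \<le> n} \<and> length ts \<le> n}"
  have L: "ts \<in> ?L" if "sum_list (map num_nodes ts) \<le> n" for ts
  proof -
    have "num_nodes t \<le> n" if "t \<in> set ts" for t
      using member_le_sum_list[of "num_nodes t" "map num_nodes ts"] that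
        \<open>sum_list (map num_nodes ts) \<le> n\<close> by simp
    moreover have "length ts \<le> n"
      using length_le_sum_num_nodes[of ts] that by linarith
    ultimately show ?thesis by auto
  qed
  have "{t. num_nodes t \<le> Suc n} \<subseteq> (\<lambda>(ls, rs). Node ls rs) ` (?L \<times> ?L)"
  proof
    fix t assume t: "t \<in> {t. num_nodes t \<le> Suc n}"
    obtain ls rs where [simp]: "t = Node ls rs" by (cases t)
    have "ls \<in> ?L" "rs \<in> ?L" using t by (auto intro!: L simp del: mem_Collect_eq)
    then show "t \<in> (\<lambda>(ls, rs). Node ls rs) ` (?L \<times> ?L)" by (auto simp: image_iff)
  qed
  moreover have "finite ?L" by (rule finite_lists_length_le[OF Suc.IH])
  ultimately show ?case by (meson finite_SigmaI finite_imageI finite_subset)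
qed

lemma finite_dep_trees: "finite {t. num_nodes t = n}"
  by (rule finite_subset[OF _ finite_dep_trees_le[of n]]) auto

(* Hence 1 - dep_tree_gf has an invertible constant coefficient and division by it is genuine. *)
lemma dep_tree_gf_nth_0: "fps_nth dep_tree_gf 0 = 0"
proof -
  have "num_nodes t \<noteq> 0" for t by (cases t) simp
  then have "{t. num_nodes t = 0} = {}" by blast
  then have "card {t. num_nodes t = 0} = 0" by (simp only: card.empty)
  then show ?thesis by (simp add: dep_tree_gf_def ogf_def)
qed

end

theory Submission
  imports Defs
begin

text \<open>
  Counting a sequence by its first entry gives \<open>S = 1 + T S\<close> for the generating function \<open>S\<close> of
  \<open>SEQ(\<T>)\<close>, so \<open>S = 1 / (1 - T)\<close>; cutting a tree at its root gives \<open>T = z S\<^sup>2\<close>.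
\<close>

text \<open>Taking preimages under a bijection preserves the cardinality of each size class. It lets
  trees be counted as pairs of lists.\<close>

lemma ogf_bij:
  assumes "bij f"
  shows "ogf (\<lambda>x. s (f x)) = ogf s"
proof -
  have "card {x. s (f x) = n} = card {y. s y = n}" for n
    using card_vimage_inj[of f "{y. s y = n}"] assms
    by (simp add: bij_is_inj bij_is_surj vimage_def)
  then show ?thesis by (simp add: ogf_def)
qed

lemma ogf_Suc: "ogf (\<lambda>x. Suc (s x)) = fps_X * ogf s"
proof (rule fps_ext)
  fix n show "fps_nth (ogf (\<lambda>x. Suc (s x))) n = fps_nth (fps_X * ogf s) n"
    by (cases n) (simp_all add: ogf_def)
qed

text \<open>Splitting the pairs of total size \<open>n\<close> by the size of the first component
  gives the Cauchy product; finiteness makes \<open>card\<close> additive over this disjoint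
  union.\<close>

lemma ogf_prod:
  assumes "\<And>n. finite {x. s x = n}" and "\<And>n. finite {y. t y = n}"
  shows "ogf (\<lambda>(x, y). s x + t y) = ogf s * ogf t"
proof (rule fps_ext)
  fix n
  have "{p. (case p of (x, y) \<Rightarrow> s x + t y) = n} = (\<Union>i\<in>{0..n}. {x. s x = i} \<times> {y. t y = n - i})"
    by auto
  also have "card \<dots> = (\<Sum>i=0..n. card ({x. s x = i} \<times> {y. t y = n - i}))"
    by (rule card_UN_disjoint) (auto simp: assms)
  finally show "fps_nth (ogf (\<lambda>(x, y). s x + t y)) n = fps_nth (ogf s * ogf t) n"
    by (simp add: ogf_def fps_mult_nth card_cartesian_product)
qed

text \<open>As every entry has positive size, the total size bounds the length as well as each
  entry.\<close>

lemma finite_lists_sum_list_eq: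
  fixes s :: "'b \<Rightarrow> nat"
  assumes fin: "\<And>n. finite {x. s x = n}" and pos: "\<And>x. 0 < s x"
  shows "finite {xs. sum_list (map s xs) = n}"
proof (rule finite_subset)
  have length_le: "length xs \<le> sum_list (map s xs)" for xs
  proof (induction xs)
    case (Cons x xs)
    then show ?case using pos[of x] by simp
  qed simp
  have member_le: "s x \<le> sum_list (map s xs)" if "x \<in> set xs" for x xs
    using that by (intro member_le_sum_list) simp_all
  show "{xs. sum_list (map s xs) = n} \<subseteq> {xs. set xs \<subseteq> (\<Union>i\<in>{..n}. {x. s x = i}) \<and> length xs \<le> n}"
    using length_le member_le by auto
  show "finite {xs. set xs \<subseteq> (\<Union>i\<in>{..n}. {x. s x = i}) \<and> length xs \<le> n}"
    by (rule finite_lists_length_le) (simp add: fin)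
qed

text \<open>A nonempty list is a head paired with a tail. The recursive form avoids subtraction and
  division, so it makes sense over semirings.\<close>

lemma ogf_lists:
  fixes s :: "'b \<Rightarrow> nat"
  assumes fin: "\<And>n. finite {x. s x = n}" and pos: "\<And>x. 0 < s x"
  shows "ogf (\<lambda>xs. sum_list (map s xs)) = 1 + ogf s * ogf (\<lambda>xs. sum_list (map s xs))"
proof -
  let ?w = "\<lambda>xs. sum_list (map s xs)"
  let ?p = "\<lambda>(x, xs). s x + ?w xs"
  have fin_lists: "finite {xs. ?w xs = n}" for n
    using fin pos by (rule finite_lists_sum_list_eq)
  have "ogf ?w = 1 + ogf ?p"
  proof (rule fps_ext)
    fix n
    \<comment> \<open>\<open>?A\<close> is a singleton for \<open>n = 0\<close> and empty otherwise,
      so its cardinality is the coefficient of the series \<open>1\<close>.\<close>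
    let ?A = "{xs :: 'b list. xs = [] \<and> n = 0}" and ?B = "(\<lambda>(x, xs). x # xs) ` {p. ?p p = n}"
    have split: "{xs. ?w xs = n} = ?A \<union> ?B"
    proof (rule set_eqI)
      fix xs show "xs \<in> {xs. ?w xs = n} \<longleftrightarrow> xs \<in> ?A \<union> ?B"
        by (cases xs) (auto simp: image_iff)
    qed
    have "finite ?A" "finite ?B"
      using fin_lists[of n] unfolding split by simp_all
    then have "card {xs. ?w xs = n} = card ?A + card ?B"
      unfolding split by (rule card_Un_disjoint) auto
    also have "card ?B = card {p. ?p p = n}"
      by (rule card_image) (auto simp: inj_on_def)
    finally show "fps_nth (ogf ?w) n = fps_nth (1 + ogf ?p) n"
      by (simp add: ogf_def)
  qed
  also have "ogf ?p = ogf s * ogf ?w"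
    using fin fin_lists by (rule ogf_prod)
  finally show ?thesis .
qed

lemma num_nodes_pos: "0 < num_nodes t"
  by (cases t) simp

lemma bij_Node: "bij (\<lambda>(ls, rs). Node ls rs)"
proof (rule bijI')
  fix t :: dep_tree
  show "\<exists>p. t = (case p of (ls, rs) \<Rightarrow> Node ls rs)"
    by (cases t) auto
qed auto

theorem mainTheorem1:
  shows "(dep_tree_gf :: 'a::field_char_0 fps)
           = 1 / (1 - dep_tree_gf) * fps_X * (1 / (1 - dep_tree_gf))"
proof -
  let ?T = "dep_tree_gf :: 'a fps"
  let ?w = "\<lambda>ts. sum_list (map num_nodes ts)"
  let ?S = "ogf ?w :: 'a fps"
  have "?S = 1 + ?T * ?S"
    unfolding dep_tree_gf_def by (rule ogf_lists[OF finite_dep_trees num_nodes_pos])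
  then have "?S * (1 - ?T) = 1"
    by (simp add: algebra_simps)
  \<comment> \<open>A zero factor would contradict the product being \<open>1\<close>; being
    nonzero, \<open>1 - ?T\<close> can be cancelled in the division.\<close>
  moreover have "1 - ?T \<noteq> 0"
    using calculation by auto
  ultimately have S: "?S = 1 / (1 - ?T)"
    by (metis nonzero_mult_div_cancel_right)
  have fin_lists: "finite {ts. ?w ts = n}" for n
    using finite_dep_trees num_nodes_pos by (rule finite_lists_sum_list_eq)
  have "?T = ogf (\<lambda>p. num_nodes (case p of (ls, rs) \<Rightarrow> Node ls rs))"
    unfolding dep_tree_gf_def by (rule ogf_bij[OF bij_Node, symmetric])
  \<comment> \<open>The root's contribution is pulled out as \<open>Suc\<close>, which becomes the
    factor \<open>fps_X\<close>.\<close>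
  also have "\<dots> = ogf (\<lambda>p. Suc (case p of (ls, rs) \<Rightarrow> ?w ls + ?w rs))"
    by (rule arg_cong[where f = ogf]) auto
  also have "\<dots> = fps_X * (?S * ?S)"
    using fin_lists by (simp only: ogf_Suc ogf_prod)
  also have "\<dots> = ?S * fps_X * ?S"
    by (simp only: mult_ac)
  finally show ?thesis
    unfolding S .
qed

end
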